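(* Let $(x,y)\in\mathbb{R}^2$ and $\theta\in\mathbb{R}$, and put $\theta_m=2\,\mathrm{atan2}(y,x)$. Suppose $$\big(0<\theta_m \land (\theta_m/2<\theta\le\theta_m \ \lor\ -2\pi<\theta<\theta_m/2-2\pi)\big)\ \lor\ \big(\theta_m<0\land(\theta_m\le\theta<\theta_m/2\ \lor\ \theta_m/2+2\pi<\theta<2\pi)\big).$$ Let $r=R(x,y,\theta)=\dfrac{x\sin\theta-y\cos\theta}{1-\cos\theta}$. Then a vehicle following a turn-to-bearing trajectory can approach $(x,y)$ with angle $\theta$ using radius $r$; that is, $r\neq 0$, $0<r\theta<2\pi|r|$, and there is $d\ge r\theta$ with $H_{r,\theta}(d)=(x,y)$.
   Context: Turn-to-bearing paths in standard position: the vehicle starts at the origin heading in the $+x$ direction. Given a signed radius $r\neq0$ ($r>0$ is a counterclockwise/left turn, $r<0$ clockwise/right) and a signed bearing offset $\theta_c$ with $0<r\theta_c<2\pi|r|$, the path parameterized by distance travelled $d\ge 0$ is $H_{r,\theta_c}(d)=(r\sin(d/r),\ r(1-\cos(d/r)))$ for $d\le r\theta_c$ and $H_{r,\theta_c}(d)=((d-r\theta_c)\cos\theta_c+r\sin\theta_c,\ (d-r\theta_c)\sin\theta_c+r(1-\cos\theta_c))$ for $d>r\theta_c$ (a circular arc of radius $|r|$ followed by the tangent straight line with heading $\theta_c$). "Approaching $(x,y)$ with angle $\theta_c$" means the path reaches $(x,y)$ at some distance $d\ge r\theta_c$, i.e. with heading $\theta_c$. Here $\mathrm{atan2}(y,x)\in(-\pi,\pi]$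 denotes the polar angle of $(x,y)$.
   Formalization: The formal statement additionally assumes 1 − cos θ ≠ 0, which excludes only the case y = 0, x < 0, θ = θ_m = 2π, where R(x,y,θ) is 0/0 and no r satisfies 0 < rθ < 2π|r|. *)

theory Defs
  imports "HOL-Analysis.Analysis"
begin

definition atan2 :: "real \<Rightarrow> real \<Rightarrow> real" where
  "atan2 y x = Arg (Complex x y)"

(* Position after distance d, starting at the origin with heading +x: an arc of signed
   radius r (r > 0 turns left, r < 0 turns right) and length r * \<theta>, followed by the tangent
   line with heading \<theta>. Meaningful for d \<ge> 0, r \<noteq> 0 and 0 < r * \<theta> < 2 * pi * \<bar>r\<bar>. *)
definition turn_to_bearing_path :: "real \<Rightarrow> real \<Rightarrow> real \<Rightarrow> real \<times> real" where
  "turn_to_bearing_path r \<theta> d =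
     (if d \<le> r * \<theta> then (r * sin (d / r), r * (1 - cos (d / r)))
      else ((d - r * \<theta>) * cos \<theta> + r * sin \<theta>, (d - r * \<theta>) * sin \<theta> + r * (1 - cos \<theta>)))"

(* The quotient is meaningful only when cos \<theta> \<noteq> 1; otherwise division by zero yields the
   junk value 0. *)
definition turn_radius :: "real \<Rightarrow> real \<Rightarrow> real \<Rightarrow> real" where
  "turn_radius x y \<theta> = (x * sin \<theta> - y * cos \<theta>) / (1 - cos \<theta>)"

end

(* In polar coordinates (x, y) = \<rho> (cos \<phi>, sin \<phi>) the radius is
   \<rho> sin (\<theta> - \<phi>) / (1 - cos \<theta>), and the tangent segment that ends at (x, y) has signed length
   \<rho> (cos (\<theta> - \<phi>) - cos \<phi>) / (1 - cos \<theta>). So everything reduces to: \<bar>\<theta>\<bar> < 2 * pi,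
   sin (\<theta> - \<phi>) has the sign of \<theta>, and cos \<phi> \<le> cos (\<theta> - \<phi>). *)
theory Submission
  imports Defs
begin

text \<open>The boundary \<open>l = 0\<close> falls into the arc branch, where
  \<open>d / r = \<theta>\<close> gives the same point as the line formula. Hence one formula serves
  all of \<open>d \<ge> r * \<theta>\<close>.\<close>

lemma turn_to_bearing_path_tangent:
  assumes "r \<noteq> 0" "0 \<le> l"
  shows "turn_to_bearing_path r \<theta> (r * \<theta> + l) = (l * cos \<theta> + r * sin \<theta>, l * sin \<theta> + r * (1 - cos \<theta>))"
  using assms by (cases "l = 0") (auto simp: turn_to_bearing_path_def)

lemma turn_radius_polar:
  "turn_radius (\<rho> * cos \<phi>) (\<rho> * sin \<phi>) \<theta> = \<rho> * sin (\<theta> - \<phi>) / (1 - cos \<theta>)"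
  by (simp add: turn_radius_def sin_diff algebra_simps)

text \<open>The two conclusions form a linear system in \<open>l\<close> and \<open>r\<close> with
  determinant \<open>cos \<theta> - 1\<close>; the given values are its solution by Cramer's
  rule.\<close>

lemma tangent_endpoint_polar:
  fixes \<rho> \<phi> \<theta> :: real
  assumes "cos \<theta> \<noteq> 1"
  defines "r \<equiv> \<rho> * sin (\<theta> - \<phi>) / (1 - cos \<theta>)"
    and "l \<equiv> \<rho> * (cos (\<theta> - \<phi>) - cos \<phi>) / (1 - cos \<theta>)"
  shows "l * cos \<theta> + r * sin \<theta> = \<rho> * cos \<phi>"
    and "l * sin \<theta> + r * (1 - cos \<theta>) = \<rho> * sin \<phi>"
proof -
  \<comment> \<open>Writing \<phi> as \<theta> - (\<theta> - \<phi>) expresses both targets through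
    the angles that occur in \<open>r\<close> and \<open>l\<close>.\<close>
  have c: "cos \<phi> = cos \<theta> * cos (\<theta> - \<phi>) + sin \<theta> * sin (\<theta> - \<phi>)"
    using cos_diff[of \<theta> "\<theta> - \<phi>"] by simp
  have s: "sin \<phi> = sin \<theta> * cos (\<theta> - \<phi>) - cos \<theta> * sin (\<theta> - \<phi>)"
    using sin_diff[of \<theta> "\<theta> - \<phi>"] by simp
  have nz: "1 - cos \<theta> \<noteq> 0"
    using assms(1) by simp
  have "l * cos \<theta> + r * sin \<theta>
      = \<rho> * ((cos (\<theta> - \<phi>) - cos \<phi>) * cos \<theta> + sin (\<theta> - \<phi>) * sin \<theta>) / (1 - cos \<theta>)"
    by (simp add: l_def r_def add_divide_distrib[symmetric] algebra_simps)
  also have "(cos (\<theta> - \<phi>) - cos \<phi>) * cos \<theta> + sin (\<theta> - \<phi>) * sin \<theta> = cos \<phi> * (1 - cos \<theta>)"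
    using c by (simp add: algebra_simps)
  finally show "l * cos \<theta> + r * sin \<theta> = \<rho> * cos \<phi>"
    using nz by simp
  have "l * sin \<theta> + r * (1 - cos \<theta>)
      = \<rho> * ((cos (\<theta> - \<phi>) - cos \<phi>) * sin \<theta> + sin (\<theta> - \<phi>) * (1 - cos \<theta>)) / (1 - cos \<theta>)"
    by (simp add: l_def r_def add_divide_distrib[symmetric] algebra_simps)
  also have "(cos (\<theta> - \<phi>) - cos \<phi>) * sin \<theta> + sin (\<theta> - \<phi>) * (1 - cos \<theta>) = sin \<phi> * (1 - cos \<theta>)"
  proof -
    have "cos \<phi> * sin \<theta> - sin (\<theta> - \<phi>) = cos \<theta> * sin \<phi>"
      by (simp add: sin_diff)
    moreover have "(cos (\<theta> - \<phi>) - cos \<phi>) * sin \<theta> + sin (\<theta> - \<phi>) * (1 - cos \<theta>)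
        = sin \<phi> - (cos \<phi> * sin \<theta> - sin (\<theta> - \<phi>))"
      unfolding s by (simp add: algebra_simps)
    ultimately show ?thesis
      by (simp add: algebra_simps)
  qed
  finally show "l * sin \<theta> + r * (1 - cos \<theta>) = \<rho> * sin \<phi>"
    using nz by simp
qed

text \<open>Since \<open>1 - cos \<theta>\<close> is positive, \<open>sgn\<close> makes the arc
  length \<open>r * \<theta>\<close> positive and \<open>cos\<close> makes the tangent length
  nonnegative; the bound on \<open>\<bar>\<theta>\<bar>\<close> keeps the arc below a full circle.
  The witness is arc length plus tangent length.\<close>

lemma turn_to_bearing_polar:
  fixes \<rho> \<phi> \<theta> :: real
  assumes "0 < \<rho>" "cos \<theta> \<noteq> 1" "\<bar>\<theta>\<bar> < 2 * pi"
    and sgn: "0 < sin (\<theta> - \<phi>) * \<theta>"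
    and cos: "cos \<phi> \<le> cos (\<theta> - \<phi>)"
  defines "r \<equiv> turn_radius (\<rho> * cos \<phi>) (\<rho> * sin \<phi>) \<theta>"
  shows "r \<noteq> 0 \<and> 0 < r * \<theta> \<and> r * \<theta> < 2 * pi * \<bar>r\<bar> \<and>
         (\<exists>d \<ge> r * \<theta>. turn_to_bearing_path r \<theta> d = (\<rho> * cos \<phi>, \<rho> * sin \<phi>))"
proof -
  define l where "l = \<rho> * (cos (\<theta> - \<phi>) - cos \<phi>) / (1 - cos \<theta>)"
  have pos: "0 < 1 - cos \<theta>"
    using assms(2) cos_le_one[of \<theta>] by linarith
  have r: "r = \<rho> * sin (\<theta> - \<phi>) / (1 - cos \<theta>)"
    by (simp add: r_def turn_radius_polar)
  have "r * \<theta> = \<rho> / (1 - cos \<theta>) * (sin (\<theta> - \<phi>) * \<theta>)"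
    by (simp add: r)
  then have r\<theta>: "0 < r * \<theta>"
    using assms(1) pos sgn by (metis divide_pos_pos mult_pos_pos)
  then have r0: "r \<noteq> 0"
    by auto
  have "r * \<theta> \<le> \<bar>r\<bar> * \<bar>\<theta>\<bar>"
    by (metis abs_ge_self abs_mult)
  also have "\<dots> < 2 * pi * \<bar>r\<bar>"
    using assms(3) r0 by (simp add: mult.commute)
  finally have lt: "r * \<theta> < 2 * pi * \<bar>r\<bar>" .
  have l0: "0 \<le> l"
    using assms(1) pos cos by (simp add: l_def)
  have "turn_to_bearing_path r \<theta> (r * \<theta> + l) = (\<rho> * cos \<phi>, \<rho> * sin \<phi>)"
    using tangent_endpoint_polar[OF assms(2), of \<rho> \<phi>]
    by (simp add: turn_to_bearing_path_tangent[OF r0 l0] r[symmetric] l_def[symmetric])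
  then show ?thesis
    using r0 r\<theta> lt l0 by (metis le_add_same_cancel1)
qed

theorem theorem1:
  fixes x y \<theta> \<theta>\<^sub>m r :: real
  assumes theta_m: "\<theta>\<^sub>m = 2 * atan2 y x"
    and region:
      "(0 < \<theta>\<^sub>m \<and> (\<theta>\<^sub>m / 2 < \<theta> \<and> \<theta> \<le> \<theta>\<^sub>m \<or> - 2 * pi < \<theta> \<and> \<theta> < \<theta>\<^sub>m / 2 - 2 * pi)) \<or>
       (\<theta>\<^sub>m < 0 \<and> (\<theta>\<^sub>m \<le> \<theta> \<and> \<theta> < \<theta>\<^sub>m / 2 \<or> \<theta>\<^sub>m / 2 + 2 * pi < \<theta> \<and> \<theta> < 2 * pi))"
    and radius_defined: "1 - cos \<theta> \<noteq> 0"
    and radius: "r = turn_radius x y \<theta>"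
  shows "r \<noteq> 0 \<and> 0 < r * \<theta> \<and> r * \<theta> < 2 * pi * \<bar>r\<bar> \<and>
         (\<exists>d \<ge> r * \<theta>. turn_to_bearing_path r \<theta> d = (x, y))"
proof -
  define \<phi> where "\<phi> = atan2 y x"
  define \<rho> where "\<rho> = cmod (Complex x y)"
  have \<theta>\<^sub>m: "\<theta>\<^sub>m = 2 * \<phi>"
    by (simp add: theta_m \<phi>_def)
  have \<phi>: "- pi < \<phi>" "\<phi> \<le> pi"
    using Arg_bounded[of "Complex x y"] by (auto simp: \<phi>_def atan2_def)
  \<comment> \<open>At the origin \<open>Arg\<close> takes its default value 0, so
    \<open>\<theta>\<^sub>m = 0\<close>, which both alternatives of \<open>region\<close>
    exclude.\<close>
  have "Complex x y \<noteq> 0"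
    using region \<theta>\<^sub>m Arg_zero by (auto simp: \<phi>_def atan2_def)
  then have \<rho>: "0 < \<rho>"
    by (simp add: \<rho>_def)
  have xy: "x = \<rho> * cos \<phi>" "y = \<rho> * sin \<phi>"
    using rcis_cmod_Arg[of "Complex x y"] unfolding \<rho>_def \<phi>_def atan2_def
    by (metis Re_rcis complex.sel(1), metis Im_rcis complex.sel(2))
  \<comment> \<open>For a target on the negative x-axis, \<phi> = pi and the closed bound
    \<open>\<theta> \<le> \<theta>\<^sub>m\<close> would admit \<open>\<theta> = 2 * pi\<close>,
    where the radius is undefined.\<close>
  have ne: "cos \<theta> \<noteq> 1" "\<theta> \<noteq> 2 * pi"
    using radius_defined by auto
  from region[unfolded \<theta>\<^sub>m] consider
      (1) "0 < \<phi>" "\<phi> < \<theta>" "\<theta> \<le> 2 * \<phi>"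
    | (2) "0 < \<phi>" "- 2 * pi < \<theta>" "\<theta> < \<phi> - 2 * pi"
    | (3) "\<phi> < 0" "2 * \<phi> \<le> \<theta>" "\<theta> < \<phi>"
    | (4) "\<phi> < 0" "\<phi> + 2 * pi < \<theta>" "\<theta> < 2 * pi"
    by auto
  \<comment> \<open>In every case \<theta> - \<phi> is, up to sign and a multiple of 2 pi, an angle
    in the interval from 0 (excluded) to \<open>\<bar>\<phi>\<bar>\<close>. The cosine decreases on
    [0, pi], which gives the cosine inequality; the sign chosen gives that of the sine.\<close>
  then have "\<bar>\<theta>\<bar> < 2 * pi \<and> 0 < sin (\<theta> - \<phi>) * \<theta> \<and> cos \<phi> \<le> cos (\<theta> - \<phi>)"
  proof cases
    case 1
    moreover have "\<theta> < 2 * pi" using 1 \<phi> ne(2) by linarith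
    moreover have "0 < sin (\<theta> - \<phi>)" using 1 \<phi> \<open>\<theta> < 2 * pi\<close> by (intro sin_gt_zero) auto
    moreover have "cos \<phi> \<le> cos (\<theta> - \<phi>)" using 1 \<phi> by (intro cos_monotone_0_pi_le) auto
    ultimately show ?thesis by simp
  next
    case 2
    \<comment> \<open>Here \<theta> < 0, and the reduced angle \<phi> - \<theta> - 2 pi lies
      strictly between 0 and \<phi>.\<close>
    have "0 < sin (\<phi> - (\<theta> + 2 * pi))" using 2 \<phi> by (intro sin_gt_zero) auto
    then have "sin (\<theta> - \<phi>) < 0"
      by (metis add_diff_eq diff_add_eq minus_diff_eq neg_less_0_iff_less sin_minus sin_periodic)
    moreover have "cos \<phi> \<le> cos (\<phi> - (\<theta> + 2 * pi))" using 2 \<phi> by (intro cos_monotone_0_pi_le) auto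
    then have "cos \<phi> \<le> cos (\<theta> - \<phi>)"
      by (metis diff_add_eq minus_diff_eq cos_minus cos_periodic)
    ultimately show ?thesis using 2 \<phi> by (auto intro: mult_neg_neg)
  next
    case 3
    \<comment> \<open>The angle \<phi> - \<theta> is at most -\<phi>, which is strictly below pi
      because \<open>Arg\<close> never equals -pi; thus no endpoint needs excluding, unlike in case
      1.\<close>
    have "0 < sin (\<phi> - \<theta>)" using 3 \<phi> by (intro sin_gt_zero) auto
    then have "sin (\<theta> - \<phi>) < 0" by (metis minus_diff_eq neg_less_0_iff_less sin_minus)
    moreover have "cos (- \<phi>) \<le> cos (\<phi> - \<theta>)" using 3 \<phi> by (intro cos_monotone_0_pi_le) auto
    then have "cos \<phi> \<le> cos (\<theta> - \<phi>)" by (metis minus_diff_eq cos_minus)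
    ultimately show ?thesis using 3 \<phi> by (auto intro: mult_neg_neg)
  next
    case 4
    \<comment> \<open>Mirror image of case 2: \<theta> > 0, and the reduced angle \<theta> - 2 pi -
      \<phi> lies strictly between 0 and -\<phi>.\<close>
    have eq: "\<theta> - \<phi> = (\<theta> - 2 * pi - \<phi>) + 2 * pi" by simp
    have "0 < sin (\<theta> - 2 * pi - \<phi>)" using 4 \<phi> by (intro sin_gt_zero) auto
    then have "0 < sin (\<theta> - \<phi>)" by (metis eq sin_periodic)
    moreover have "cos (- \<phi>) \<le> cos (\<theta> - 2 * pi - \<phi>)" using 4 \<phi> by (intro cos_monotone_0_pi_le) auto
    then have "cos \<phi> \<le> cos (\<theta> - \<phi>)" by (metis eq cos_minus cos_periodic)
    ultimately show ?thesis using 4 \<phi> by auto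
  qed
  then show ?thesis
    using turn_to_bearing_polar[OF \<rho> ne(1)] by (simp add: radius xy)
qed

end
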